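(* Let $k\ge 0$ be an integer and let $N$ be a positive integer. The PLRS generated by $[1,\underbrace{0,\ldots,0}_{k},N]$ is complete if and only if $1\le N\le \left\lceil \frac{(k+2)(k+3)}{4}\right\rceil$, where $\lceil\cdot\rceil$ is the ceiling function.
   Context: A positive linear recurrence sequence (PLRS) generated by $[c_1,\ldots,c_L]$, where $L\ge 1$, the $c_i$ are nonnegative integers, $c_1\ge 1$ and $c_L\ge 1$, is the sequence of positive integers $(H_n)_{n\ge1}$ with $H_1=1$, $H_{n+1}=c_1H_n+c_2H_{n-1}+\cdots+c_nH_1+1$ for $1\le n<L$, and $H_{n+1}=c_1H_n+\cdots+c_LH_{n+1-L}$ for $n\ge L$. A sequence of positive integers $(a_i)_{i\ge1}$ is complete if every positive integer $n$ can be written as $n=\sum_{i=1}^\infty \varepsilon_i a_i$ with $\varepsilon_i\in\{0,1\}$; otherwise it is incomplete. *)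

theory Defs
  imports Complex_Main
begin

text \<open>
  A generator \<open>[c\<^sub>1, \<dots>, c\<^sub>L]\<close> is a list, so the coefficient \<open>c\<^sub>i\<close> is \<open>c ! (i - 1)\<close>.
  Sequences are indexed from 1; the value at index 0 is a dummy, used neither by the
  recurrences nor by completeness.
\<close>

definition plrs_generator :: "nat list \<Rightarrow> bool" where
  "plrs_generator c \<longleftrightarrow> length c \<ge> 1 \<and> hd c \<ge> 1 \<and> last c \<ge> 1"

fun plrs :: "nat list \<Rightarrow> nat \<Rightarrow> nat" where
  "plrs c 0 = 0"
| "plrs c (Suc 0) = 1"
| "plrs c (Suc (Suc m)) =
     (let n = Suc m in
      if n < length c
      then (\<Sum>i=1..n. c ! (i - 1) * plrs c (n + 1 - i)) + 1
      else (\<Sum>i=1..length c. c ! (i - 1) * plrs c (n + 1 - i)))"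

text \<open>
  The series is taken in the discrete space of natural numbers, so it converges exactly when
  only finitely many of its terms are nonzero.
\<close>

definition complete_seq :: "(nat \<Rightarrow> nat) \<Rightarrow> bool" where
  "complete_seq a \<longleftrightarrow>
     (\<forall>n\<ge>1. \<exists>\<epsilon> :: nat \<Rightarrow> nat.
        (\<forall>i. \<epsilon> i \<in> {0, 1}) \<and> (\<lambda>i. \<epsilon> (i + 1) * a (i + 1)) sums n)"

lemma plrs_1: "plrs c 1 = 1"
  by simp

lemma plrs_initial:
  assumes "1 \<le> n" "n < length c"
  shows "plrs c (n + 1) = (\<Sum>i=1..n. c ! (i - 1) * plrs c (n + 1 - i)) + 1"
  using assms by (cases n) (simp_all add: Let_def)

lemma plrs_recurrence:
  assumes "plrs_generator c" "length c \<le> n"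
  shows "plrs c (n + 1) = (\<Sum>i=1..length c. c ! (i - 1) * plrs c (n + 1 - i))"
  using assms by (cases n) (simp_all add: Let_def plrs_generator_def)

lemma plrs_pos:
  assumes "plrs_generator c" "1 \<le> n"
  shows "plrs c n > 0"
  using assms(2)
proof (induction n rule: dec_induct)
  case base
  show ?case by simp
next
  case (step n)
  show ?case
  proof (cases "n < length c")
    case True
    then show ?thesis using plrs_initial[of n c] step by simp
  next
    case False
    have "0 < c ! (1 - 1) * plrs c (n + 1 - 1)"
      using step assms(1) by (cases c) (auto simp: plrs_generator_def)
    also have "\<dots> \<le> (\<Sum>i=1..length c. c ! (i - 1) * plrs c (n + 1 - i))"
      using assms(1) by (intro member_le_sum) (auto simp: plrs_generator_def)
    also have "\<dots> = plrs c (Suc n)"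
      using plrs_recurrence[of c n] assms(1) False by simp
    finally show ?thesis .
  qed
qed

lemma complete_seq_iff_subset_sums:
  assumes pos: "\<And>i. 1 \<le> i \<Longrightarrow> a i > 0"
  shows "complete_seq a \<longleftrightarrow> (\<forall>n\<ge>1. \<exists>S. finite S \<and> S \<subseteq> {1..} \<and> n = sum a S)"
proof -
  have "(\<exists>\<epsilon> :: nat \<Rightarrow> nat. (\<forall>i. \<epsilon> i \<in> {0, 1}) \<and> (\<lambda>i. \<epsilon> (i + 1) * a (i + 1)) sums n)
      \<longleftrightarrow> (\<exists>S. finite S \<and> S \<subseteq> {1..} \<and> n = sum a S)" (is "?L \<longleftrightarrow> ?R") for n
  proof
    assume ?L
    then obtain e :: "nat \<Rightarrow> nat" where e: "\<And>i. e i \<in> {0, 1}"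
      and s: "(\<lambda>i. e (i + 1) * a (i + 1)) sums n" by blast
    have "eventually (\<lambda>m. (\<Sum>i<m. e (i + 1) * a (i + 1)) = n) sequentially"
      using s unfolding sums_def by (simp add: tendsto_discrete)
    then obtain m where m: "(\<Sum>i<m. e (i + 1) * a (i + 1)) = n"
      by (auto simp: eventually_sequentially)
    let ?S = "{i \<in> {1..m}. e i = 1}"
    have "(\<Sum>i<m. e (i + 1) * a (i + 1)) = (\<Sum>i=1..m. e i * a i)"
      by (rule sum.reindex_bij_witness[of _ "\<lambda>i. i - 1" Suc]) auto
    also have "\<dots> = (\<Sum>i\<in>?S. e i * a i)"
    proof (rule sum.mono_neutral_right)
      show "\<forall>i\<in>{1..m} - ?S. e i * a i = 0"
      proof
        fix i assume "i \<in> {1..m} - ?S"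
        then show "e i * a i = 0" using e[of i] by auto
      qed
    qed auto
    also have "\<dots> = sum a ?S"
      by (rule sum.cong) auto
    finally have "n = sum a ?S" using m by simp
    then show ?R by (intro exI[of _ ?S]) auto
  next
    assume ?R
    then obtain S where S: "finite S" "S \<subseteq> {1..}" "n = sum a S" by blast
    let ?e = "\<lambda>i. if i \<in> S then 1 else 0 :: nat"
    let ?T = "(\<lambda>i. i - 1) ` S"
    have "(\<lambda>i. ?e (i + 1) * a (i + 1)) sums (\<Sum>i\<in>?T. ?e (i + 1) * a (i + 1))"
      by (rule sums_finite) (use S in \<open>auto simp: image_iff Bex_def\<close>)
    also have "(\<Sum>i\<in>?T. ?e (i + 1) * a (i + 1)) = sum a S"
      by (rule sum.reindex_bij_witness[of _ "\<lambda>i. i - 1" Suc]) (use S in auto)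
    finally show ?L using S by (intro exI[of _ ?e]) auto
  qed
  then show ?thesis unfolding complete_seq_def by simp
qed

lemma plrs_generator_one_zeros:
  assumes "N > 0"
  shows "plrs_generator ([1] @ replicate k 0 @ [N])"
  using assms by (simp add: plrs_generator_def)

end

theory Submission
  imports Defs
begin

text \<open>
  Put \<open>L = k + 2\<close> and \<open>D n = 1 + (H 1 + \<dots> + H n) - H (n + 1)\<close>. Brown's criterion says that the
  nondecreasing sequence \<open>H\<close> is complete iff \<open>D n \<ge> 0\<close> for all \<open>n\<close>. Summing the recurrence of \<open>H\<close>
  gives \<open>D n = D (n - 1) + N * (D (n - L) - 1) + L\<close> for \<open>n \<ge> L\<close>, with \<open>D n = n (n - 1) / 2\<close> for
  \<open>n < L\<close>. So \<open>D\<close> can only decrease at \<open>n\<close> if \<open>D (n - L) = 0\<close> and \<open>N > L\<close>. This happens at \<open>n = L\<close>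
  and \<open>n = L + 1\<close>, where \<open>D (L + 1) = 1 + L (L + 1) / 2 - 2 N\<close> is nonnegative exactly under the
  stated bound, and at most once more, at \<open>n = 2 L + 1\<close>, when \<open>D\<close> is already larger than \<open>N\<close>.
\<close>

section \<open>Brown's completeness criterion\<close>

definition brown_gap :: "(nat \<Rightarrow> nat) \<Rightarrow> nat \<Rightarrow> int" where
  "brown_gap a n = 1 + (\<Sum>i=1..n. int (a i)) - int (a (Suc n))"

lemma brown_gap_0: "brown_gap a 0 = 1 - int (a 1)"
  by (simp add: brown_gap_def)

lemma brown_gap_Suc:
  "brown_gap a (Suc n) = brown_gap a n + 2 * int (a (Suc n)) - int (a (Suc (Suc n)))"
  by (simp add: brown_gap_def)

text \<open>Greedy choice: if \<open>m\<close> exceeds the sum of the first \<open>n\<close> terms,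
  the gap at \<open>n\<close> gives \<open>a (Suc n) \<le> m\<close>, and what remains after taking
  that term is at most the shorter sum.\<close>

lemma subset_sums_of_brown_gap_nonneg:
  assumes gap: "\<And>n. brown_gap a n \<ge> 0" and "m \<le> sum a {1..n}"
  shows "\<exists>S \<subseteq> {1..n}. m = sum a S"
  using assms(2)
proof (induction n arbitrary: m)
  case 0
  then show ?case by auto
next
  case (Suc n)
  show ?case
  proof (cases "m \<le> sum a {1..n}")
    case True
    then obtain S where "S \<subseteq> {1..n}" "m = sum a S" using Suc.IH by blast
    then show ?thesis by (intro exI[of _ S]) auto
  next
    case False
    have "int (a (Suc n)) \<le> 1 + int (sum a {1..n})"
      using gap[of n] by (simp add: brown_gap_def)
    then have le: "a (Suc n) \<le> m" using False by linarith
    have "m - a (Suc n) \<le> sum a {1..n}" using Suc.prems by simp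
    then obtain S where S: "S \<subseteq> {1..n}" "m - a (Suc n) = sum a S" using Suc.IH by blast
    have "finite S" "Suc n \<notin> S" using S(1) finite_subset by auto
    then have "sum a (insert (Suc n) S) = m" using S(2) le by simp
    then show ?thesis using S(1) by (intro exI[of _ "insert (Suc n) S"]) auto
  qed
qed

theorem brown_criterion:
  assumes pos: "\<And>i. 1 \<le> i \<Longrightarrow> a i > 0"
    and mono: "\<And>i j. 1 \<le> i \<Longrightarrow> i \<le> j \<Longrightarrow> a i \<le> a j"
  shows "complete_seq a \<longleftrightarrow> (\<forall>n. brown_gap a n \<ge> 0)"
proof
  assume "complete_seq a"
  then have complete: "\<forall>n\<ge>1. \<exists>S. finite S \<and> S \<subseteq> {1..} \<and> n = sum a S"
    using complete_seq_iff_subset_sums[of a] pos by simp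
  show "\<forall>n. brown_gap a n \<ge> 0"
  proof (rule ccontr, simp add: not_le, elim exE)
    fix n assume "brown_gap a n < 0"
    then have gap: "1 + int (sum a {1..n}) < int (a (Suc n))"
      by (simp add: brown_gap_def)
    \<comment> \<open>This number is too large for indices up to \<open>n\<close>, yet smaller than
      any single later term.\<close>
    obtain S where S: "finite S" "S \<subseteq> {1..}" "1 + sum a {1..n} = sum a S"
      using complete by (metis le_add1)
    show False
    proof (cases "S \<subseteq> {1..n}")
      case True
      then have "sum a S \<le> sum a {1..n}" by (intro sum_mono2) auto
      then show False using S(3) by simp
    next
      case False
      then obtain j where j: "j \<in> S" "Suc n \<le> j" using S(2) by fastforce
      have "a (Suc n) \<le> a j" using mono[of "Suc n" j] j by simp
      also have "\<dots> \<le> sum a S" using j S(1) by (intro member_le_sum) auto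
      finally show False using gap S(3) by linarith
    qed
  qed
next
  assume gap: "\<forall>n. brown_gap a n \<ge> 0"
  have "\<exists>S. finite S \<and> S \<subseteq> {1..} \<and> n = sum a S" for n
  proof -
    have "(\<Sum>i=1..n. 1) \<le> sum a {1..n}"
      using pos by (intro sum_mono) (simp add: Suc_leI)
    then have "n \<le> sum a {1..n}" by simp
    then obtain S where "S \<subseteq> {1..n}" "n = sum a S"
      using subset_sums_of_brown_gap_nonneg[of a n n] gap by auto
    then show ?thesis by (intro exI[of _ S]) (auto intro: finite_subset)
  qed
  then show "complete_seq a"
    using complete_seq_iff_subset_sums[of a] pos by simp
qed

section \<open>Gaps of the recurrence with coefficients 1, 0, ..., 0, N\<close>

locale one_zeros_recurrence =
  fixes a :: "nat \<Rightarrow> nat" and L N :: nat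
  assumes L_ge: "2 \<le> L" and N_pos: "0 < N"
    and a_initial: "\<And>n. 1 \<le> n \<Longrightarrow> n \<le> L \<Longrightarrow> a n = n"
    and a_rec: "\<And>n. L \<le> n \<Longrightarrow> a (Suc n) = a n + N * a (Suc n - L)"
begin

abbreviation "D \<equiv> brown_gap a"

lemma a_mono:
  assumes "1 \<le> i" "i \<le> j"
  shows "a i \<le> a j"
  using assms(2)
proof (induction j rule: dec_induct)
  case (step n)
  have "a n \<le> a (Suc n)"
    using a_initial[of n] a_initial[of "Suc n"] a_rec[of n] step assms(1) by (cases "n < L") auto
  then show ?case using step by simp
qed simp

lemma a_pos: "1 \<le> i \<Longrightarrow> a i > 0"
  using a_mono[of 1 i] a_initial[of 1] L_ge by simp

lemma D_initial: "n < L \<Longrightarrow> 2 * D n = int n * (int n - 1)"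
proof (induction n)
  case 0
  then show ?case using a_initial[of 1] by (simp add: brown_gap_0)
next
  case (Suc n)
  then show ?case using a_initial[of "Suc n"] a_initial[of "Suc (Suc n)"]
    by (simp add: brown_gap_Suc algebra_simps)
qed

text \<open>Passing from \<open>m\<close> to \<open>Suc m\<close> changes the increment
  \<open>D (L + m) - D (L + m - 1)\<close> by \<open>N * (2 * a (Suc m) - a (Suc (Suc m)))\<close>,
  which is \<open>N * (D (Suc m) - D m)\<close>. This telescopes from \<open>m = 0\<close>, where
  \<open>D 0 = 0\<close>.\<close>

lemma D_rec: "D (L + m) = D (L + m - 1) + int N * (D m - 1) + int L"
proof (induction m)
  case 0
  obtain l where l: "L = Suc l" using L_ge by (cases L) auto
  have "a L = L" "a 1 = 1" "a (Suc L) = L + N * a 1"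
    using a_initial[of L] a_initial[of 1] a_rec[of L] L_ge by auto
  then show ?case using brown_gap_Suc[of a l] by (simp add: l brown_gap_0)
next
  case (Suc m)
  obtain l where l: "L = Suc l" using L_ge by (cases L) auto
  have "a (Suc (L + m)) = a (L + m) + N * a (Suc m)"
    "a (Suc (Suc (L + m))) = a (Suc (L + m)) + N * a (Suc (Suc m))"
    using a_rec[of "L + m"] a_rec[of "Suc (L + m)"] by (auto simp: Suc_diff_le)
  then show ?case
    using Suc brown_gap_Suc[of a "l + m"] brown_gap_Suc[of a "L + m"]
    by (simp add: l brown_gap_Suc[of a m] algebra_simps)
qed

lemma D_L: "D L = D (L - 1) + int L - int N"
  and D_Suc_L: "2 * D (Suc L) = 2 + int L * (int L + 1) - 4 * int N"
proof -
  have "2 * D 0 = 0" "2 * D 1 = 0" using D_initial[of 0] D_initial[of 1] L_ge by auto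
  then show DL: "D L = D (L - 1) + int L - int N"
    and "2 * D (Suc L) = 2 + int L * (int L + 1) - 4 * int N"
    using D_rec[of 0] D_rec[of 1] D_initial[of "L - 1"] L_ge
    by (simp_all add: of_nat_diff algebra_simps)
qed

text \<open>From \<open>n = L\<close> on, each step adds at least \<open>L - N \<ge> 0\<close> while
  the earlier gaps are nonnegative.\<close>

lemma D_nonneg_small:
  assumes "N \<le> L"
  shows "0 \<le> D n"
proof (induction n rule: less_induct)
  case (less n)
  show ?case
  proof (cases "n < L")
    case True
    then have "2 * D n = int n * (int n - 1)" by (rule D_initial)
    moreover have "0 \<le> int n * (int n - 1)" by (cases n) auto
    ultimately show ?thesis by simp
  next
    case False
    then obtain m where m: "n = L + m" using le_Suc_ex[of L n] by auto
    have "0 \<le> D m" "0 \<le> D (L + m - 1)" using less m L_ge by auto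
    moreover have "0 \<le> int N * D m" using \<open>0 \<le> D m\<close> by simp
    ultimately show ?thesis using D_rec[of m] assms unfolding m right_diff_distrib by linarith
  qed
qed

section \<open>Large N: positivity of the gaps away from L + 1\<close>

context
  assumes N_gt: "L < N" and gap: "0 \<le> D (Suc L)"
begin

text \<open>For \<open>L = 2\<close> and \<open>L = 3\<close>, the formula for
  \<open>D (Suc L)\<close> and \<open>gap\<close> force \<open>N \<le> L\<close>.\<close>

lemma L_ge_4: "4 \<le> L"
proof (rule ccontr)
  assume "\<not> 4 \<le> L"
  then have "L = 2 \<or> L = 3" using L_ge by auto
  then show False using N_gt gap D_Suc_L by auto
qed

lemma D_pos_initial:
  assumes "2 \<le> n" "n \<le> L"
  shows "1 \<le> D n"
proof (cases "n < L")
  case True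
  then have "2 * D n = int n * (int n - 1)" by (rule D_initial)
  moreover have "2 * 1 \<le> int n * (int n - 1)" using assms by (intro mult_mono) auto
  ultimately show ?thesis by simp
next
  case False
  \<comment> \<open>Since \<open>D 1 = 0\<close>, the step from \<open>L\<close> to
    \<open>Suc L\<close> loses \<open>N - L > 0\<close>; the result is still nonnegative, so
    \<open>D L\<close> is positive.\<close>
  have "D (Suc L) = D L + int L - int N"
    using D_rec[of 1] D_initial[of 1] L_ge by simp
  then show ?thesis using gap N_gt False assms by simp
qed

lemma D_L_plus_2: "int L \<le> D (L + 2)"
  using D_rec[of 2] D_initial[of 2] L_ge_4 gap by simp

text \<open>The value \<open>D 3 = 3\<close> causes a jump of \<open>2 * N + L\<close> at
  \<open>L + 3\<close>, and the later increments are positive by \<open>D_pos_initial\<close>. The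
  margin \<open>2 * N\<close> is kept for the possible drop at \<open>2 * L + 1\<close>.\<close>

lemma D_middle:
  assumes "L + 3 \<le> n" "n \<le> 2 * L"
  shows "2 * int N \<le> D n"
  using assms
proof (induction n rule: dec_induct)
  case base
  show ?case using D_rec[of 3] D_initial[of 3] L_ge_4 D_L_plus_2
    by (simp add: numeral_eq_Suc)
next
  case (step n)
  then obtain m where m: "Suc n = L + m" using le_Suc_ex[of L "Suc n"] by auto
  have "1 \<le> D m" using m step by (intro D_pos_initial) auto
  then have "0 \<le> int N * (D m - 1)" by simp
  moreover have "D (Suc n) = D n + int N * (D m - 1) + int L"
    using D_rec[of m] m[symmetric] by simp
  ultimately show ?case using step by simp
qed

lemma D_pos:
  assumes "2 \<le> n" "n \<noteq> Suc L"
  shows "1 \<le> D n"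
  using assms
proof (induction n rule: less_induct)
  case (less n)
  consider "n \<le> L" | "n = L + 2" | "L + 3 \<le> n" "n \<le> 2 * L" | "n = 2 * L + 1" | "2 * L + 1 < n"
    using less.prems by linarith
  then show ?case
  proof cases
    case 1
    then show ?thesis using less.prems by (intro D_pos_initial)
  next
    case 2
    then show ?thesis using D_L_plus_2 L_ge by simp
  next
    case 3
    then show ?thesis using D_middle[of n] N_pos by simp
  next
    case 4
    then have n: "n = L + Suc L" by simp
    \<comment> \<open>The recurrence looks back to \<open>D (Suc L)\<close>, which may be 0; the
      loss is then less than \<open>N\<close>.\<close>
    have "2 * int N \<le> D (L + L)" using L_ge_4 by (intro D_middle) auto
    moreover have "0 \<le> int N * D (Suc L)" using gap by simp
    ultimately show ?thesis unfolding n using D_rec[of "Suc L"] N_pos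
      by (simp add: algebra_simps)
  next
    case 5
    then obtain m where m: "n = L + m" using le_Suc_ex[of L n] by auto
    \<comment> \<open>Both \<open>m\<close> and \<open>L + m - 1\<close> are beyond
      \<open>Suc L\<close>, so the exceptional index is avoided.\<close>
    have "1 \<le> D m" "1 \<le> D (L + m - 1)" using less.IH 5 m L_ge by auto
    moreover have "0 \<le> int N * (D m - 1)" using \<open>1 \<le> D m\<close> by simp
    ultimately show ?thesis using D_rec[of m] unfolding m by linarith
  qed
qed

end

lemma D_nonneg_iff: "(\<forall>n. 0 \<le> D n) \<longleftrightarrow> 4 * int N \<le> 2 + int L * (int L + 1)"
proof
  assume "\<forall>n. 0 \<le> D n"
  then have "0 \<le> D (Suc L)" by blast
  then show "4 * int N \<le> 2 + int L * (int L + 1)" using D_Suc_L by simp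
next
  assume bound: "4 * int N \<le> 2 + int L * (int L + 1)"
  show "\<forall>n. 0 \<le> D n"
  proof (cases "N \<le> L")
    case True
    then show ?thesis using D_nonneg_small by blast
  next
    case False
    have gap: "0 \<le> D (Suc L)" using D_Suc_L bound by simp
    show ?thesis
    proof
      fix n
      consider "n = Suc L" | "n < 2" | "2 \<le> n" "n \<noteq> Suc L" by linarith
      then show "0 \<le> D n"
      proof cases
        case 2
        then show ?thesis using D_initial[of n] L_ge by (auto simp: less_2_cases_iff)
      next
        case 3
        then show ?thesis using D_pos[of n] False gap by simp
      qed (use gap in simp)
    qed
  qed
qed

lemma complete_iff: "complete_seq a \<longleftrightarrow> 4 * int N \<le> 2 + int L * (int L + 1)"
  using brown_criterion[of a] a_pos a_mono D_nonneg_iff by simp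

end

section \<open>The given PLRS and the ceiling form of the bound\<close>

lemma one_zeros_recurrence_plrs:
  assumes "N > 0"
  shows "one_zeros_recurrence (plrs ([1] @ replicate k 0 @ [N])) (k + 2) N"
proof -
  define c where "c = [1] @ replicate k 0 @ [N]"
  have coeff: "c ! i = (if i = 0 then 1 else if i = Suc k then N else 0)" if "i < k + 2" for i
    using that by (auto simp: c_def nth_append nth_Cons split: nat.splits)
  have len: "length c = k + 2" and gen: "plrs_generator c"
    using plrs_generator_one_zeros[OF assms, of k] by (simp_all add: c_def)
  show "one_zeros_recurrence (plrs ([1] @ replicate k 0 @ [N])) (k + 2) N"
    unfolding c_def[symmetric]
  proof
    show "2 \<le> k + 2" "0 < N" using assms by auto
    show "plrs c n = n" if "1 \<le> n" "n \<le> k + 2" for n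
      using that
    proof (induction n rule: dec_induct)
      case base
      show ?case by simp
    next
      case (step n)
      have "(\<Sum>i=1..n. c ! (i - 1) * plrs c (n + 1 - i)) = (\<Sum>i=1..n. if i = 1 then plrs c n else 0)"
        using step by (intro sum.cong) (auto simp: coeff)
      also have "\<dots> = plrs c n" using step by simp
      finally show ?case using plrs_initial[of n c] len step by simp
    qed
    show "plrs c (Suc n) = plrs c n + N * plrs c (Suc n - (k + 2))" if "k + 2 \<le> n" for n
    proof -
      have "plrs c (n + 1) = (\<Sum>i=1..k + 2. c ! (i - 1) * plrs c (n + 1 - i))"
        using plrs_recurrence[of c n] gen len that by simp
      \<comment> \<open>The two nonzero coefficients sit at distinct indices as
        \<open>k + 2 > 1\<close>, so the sum splits into two one-point sums.\<close>
      also have "\<dots> = (\<Sum>i=1..k + 2. (if i = 1 then plrs c n else 0)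
          + (if i = k + 2 then N * plrs c (Suc n - (k + 2)) else 0))"
        by (intro sum.cong) (auto simp: coeff)
      also have "\<dots> = plrs c n + N * plrs c (Suc n - (k + 2))"
        by (simp add: sum.distrib del: sum.cl_ivl_Suc)
      finally show ?thesis by simp
    qed
  qed
qed

text \<open>An integer is at most a ceiling iff its predecessor is below the argument. The product
  of consecutive integers is even, so being greater than \<open>4 * N - 4\<close> means being at
  least \<open>4 * N - 2\<close>.\<close>

lemma le_ceiling_quarter_iff:
  "int N \<le> \<lceil>((real k + 2) * (real k + 3)) / 4\<rceil> \<longleftrightarrow> 4 * int N \<le> 2 + int (k + 2) * (int (k + 2) + 1)"
proof -
  have "int N \<le> \<lceil>((real k + 2) * (real k + 3)) / 4\<rceil>
      \<longleftrightarrow> real_of_int (4 * int N - 4) < real_of_int (int (k + 2) * (int (k + 2) + 1))"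
    by (simp add: le_ceiling_iff field_simps)
  also have "\<dots> \<longleftrightarrow> 4 * int N - 4 < int (k + 2) * (int (k + 2) + 1)"
    by (rule of_int_less_iff)
  also have "\<dots> \<longleftrightarrow> 4 * int N \<le> 2 + int (k + 2) * (int (k + 2) + 1)"
  proof -
    have "even (int (k + 2) * (int (k + 2) + 1))" by simp
    then obtain t where t: "int (k + 2) * (int (k + 2) + 1) = 2 * t" by (rule evenE)
    show ?thesis unfolding t by presburger
  qed
  finally show ?thesis .
qed

theorem theorem1p15:
  fixes k N :: nat
  assumes "N > 0"
  shows "complete_seq (plrs ([1] @ replicate k 0 @ [N])) \<longleftrightarrow>
    1 \<le> N \<and> int N \<le> \<lceil>((real k + 2) * (real k + 3)) / 4\<rceil>"
  unfolding one_zeros_recurrence.complete_iff[OF one_zeros_recurrence_plrs[OF assms]]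
    le_ceiling_quarter_iff
  using assms by simp

end
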